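(* Let $\mathbb{M}$ be a monster model of a complete $C$-minimal expansion of ACVF whose language contains a constant symbol $t$ with $v(t)>0$. Let $B\subseteq\mathbb{M}$ be a ball and $f:B\to\mathbb{M}$ a definable function that is differentiable on $B$. Then for all but finitely many $a\in B$, $$\lim_{(x,y)\to(a,a),\ x\neq y}\frac{f(x)-f(y)}{x-y}=f'(a).$$
   Context: ACVF is the theory of algebraically closed non-trivially valued fields; $C$-minimal means every definable subset of the home sort is a finite boolean combination of balls and points. "Definable" means with parameters; topology is the valuation topology. *)

theory Defs
  imports
    "HOL-Analysis.Abstract_Limits"
    "HOL-Analysis.Product_Topology"
    "HOL-Computational_Algebra.Polynomial"
    "HOL-Library.Extended"
begin

unbundle cardinal_syntax

section \<open>First-order logic\<close>

text \<open>One-sorted first-order languages with equality. The symbols are the elements of the types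
  \<open>'f\<close> and \<open>'r\<close>; constant symbols are function symbols of arity 0.\<close>

record ('f, 'r) language =
  fun_arity :: "'f \<Rightarrow> nat"
  rel_arity :: "'r \<Rightarrow> nat"

datatype 'f fo_term = Var nat | App 'f "'f fo_term list"

datatype ('f, 'r) fo_formula =
    Eq "'f fo_term" "'f fo_term"
  | Rel 'r "'f fo_term list"
  | Neg "('f, 'r) fo_formula"
  | Conj "('f, 'r) fo_formula" "('f, 'r) fo_formula"
  | Exi nat "('f, 'r) fo_formula"

fun wf_term :: "('f, 'r, 'z) language_scheme \<Rightarrow> 'f fo_term \<Rightarrow> bool" where
  "wf_term L (Var n) = True"
| "wf_term L (App g ts) = (length ts = fun_arity L g \<and> (\<forall>s \<in> set ts. wf_term L s))"

fun wf_formula :: "('f, 'r, 'z) language_scheme \<Rightarrow> ('f, 'r) fo_formula \<Rightarrow> bool" where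
  "wf_formula L (Eq s u) = (wf_term L s \<and> wf_term L u)"
| "wf_formula L (Rel R ts) = (length ts = rel_arity L R \<and> (\<forall>s \<in> set ts. wf_term L s))"
| "wf_formula L (Neg \<phi>) = wf_formula L \<phi>"
| "wf_formula L (Conj \<phi> \<psi>) = (wf_formula L \<phi> \<and> wf_formula L \<psi>)"
| "wf_formula L (Exi n \<phi>) = wf_formula L \<phi>"

fun vars_term :: "'f fo_term \<Rightarrow> nat set" where
  "vars_term (Var n) = {n}"
| "vars_term (App g ts) = (\<Union>s \<in> set ts. vars_term s)"

fun free_vars :: "('f, 'r) fo_formula \<Rightarrow> nat set" where
  "free_vars (Eq s u) = vars_term s \<union> vars_term u"
| "free_vars (Rel R ts) = (\<Union>s \<in> set ts. vars_term s)"
| "free_vars (Neg \<phi>) = free_vars \<phi>"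
| "free_vars (Conj \<phi> \<psi>) = free_vars \<phi> \<union> free_vars \<psi>"
| "free_vars (Exi n \<phi>) = free_vars \<phi> - {n}"

text \<open>The universe of a structure is the whole type \<open>'a\<close>. Only the values of the interpretations
  on argument lists of the correct length matter.\<close>

record ('f, 'r, 'a) fo_structure =
  fun_interp :: "'f \<Rightarrow> 'a list \<Rightarrow> 'a"
  rel_interp :: "'r \<Rightarrow> 'a list \<Rightarrow> bool"

fun eval_term :: "('f, 'r, 'a) fo_structure \<Rightarrow> (nat \<Rightarrow> 'a) \<Rightarrow> 'f fo_term \<Rightarrow> 'a" where
  "eval_term M e (Var n) = e n"
| "eval_term M e (App g ts) = fun_interp M g (map (eval_term M e) ts)"

fun sat :: "('f, 'r, 'a) fo_structure \<Rightarrow> (nat \<Rightarrow> 'a) \<Rightarrow> ('f, 'r) fo_formula \<Rightarrow> bool" where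
  "sat M e (Eq s u) = (eval_term M e s = eval_term M e u)"
| "sat M e (Rel R ts) = rel_interp M R (map (eval_term M e) ts)"
| "sat M e (Neg \<phi>) = (\<not> sat M e \<phi>)"
| "sat M e (Conj \<phi> \<psi>) = (sat M e \<phi> \<and> sat M e \<psi>)"
| "sat M e (Exi n \<phi>) = (\<exists>x. sat M (e(n := x)) \<phi>)"

text \<open>Definability with parameters, for sets of \<open>n\<close>-tuples: the variables \<open>0, \<dots>, n - 1\<close> stand for
  the tuple, and the environment \<open>e\<close> supplies the parameters as the values of the other variables.\<close>

definition definable ::
  "('f, 'r, 'z) language_scheme \<Rightarrow> ('f, 'r, 'a) fo_structure \<Rightarrow> nat \<Rightarrow> 'a list set \<Rightarrow> bool" where
  "definable L M n X \<longleftrightarrow>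
     (\<exists>\<phi> e. wf_formula L \<phi> \<and>
        X = {xs. length xs = n \<and> sat M (\<lambda>i. if i < n then xs ! i else e i) \<phi>})"

definition definable_set ::
  "('f, 'r, 'z) language_scheme \<Rightarrow> ('f, 'r, 'a) fo_structure \<Rightarrow> 'a set \<Rightarrow> bool" where
  "definable_set L M X \<longleftrightarrow> definable L M 1 {[x] | x. x \<in> X}"

text \<open>A function on \<open>B\<close> is represented by a total function, of which only the graph over \<open>B\<close>
  is used.\<close>

definition definable_function_on ::
  "('f, 'r, 'z) language_scheme \<Rightarrow> ('f, 'r, 'a) fo_structure \<Rightarrow> 'a set \<Rightarrow> ('a \<Rightarrow> 'a) \<Rightarrow> bool" where
  "definable_function_on L M B f \<longleftrightarrow> definable L M 2 {[x, f x] | x. x \<in> B}"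


section \<open>Monster models\<close>

text \<open>A 1-type over \<open>A\<close> is a set \<open>p\<close> of pairs \<open>(\<phi>, e)\<close>: the formula \<open>\<phi>\<close> in the variable \<open>0\<close>, whose
  other free variables have been replaced by their values under \<open>e\<close>, which lie in \<open>A\<close>.\<close>

definition realizes ::
  "('f, 'r, 'a) fo_structure \<Rightarrow> 'a \<Rightarrow> (('f, 'r) fo_formula \<times> (nat \<Rightarrow> 'a)) set \<Rightarrow> bool" where
  "realizes M x p \<longleftrightarrow> (\<forall>(\<phi>, e) \<in> p. sat M (e(0 := x)) \<phi>)"

definition saturated ::
  "('f, 'r, 'z) language_scheme \<Rightarrow> ('f, 'r, 'a) fo_structure \<Rightarrow> 'k rel \<Rightarrow> bool" where
  "saturated L M \<kappa> \<longleftrightarrow>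
     (\<forall>A p. |A| <o \<kappa> \<and>
        (\<forall>(\<phi>, e) \<in> p. wf_formula L \<phi> \<and> e ` (free_vars \<phi> - {0}) \<subseteq> A) \<and>
        (\<forall>q \<subseteq> p. finite q \<longrightarrow> (\<exists>x. realizes M x q))
      \<longrightarrow> (\<exists>x. realizes M x p))"

definition partial_elementary ::
  "('f, 'r, 'z) language_scheme \<Rightarrow> ('f, 'r, 'a) fo_structure \<Rightarrow> 'a set \<Rightarrow> ('a \<Rightarrow> 'a) \<Rightarrow> bool" where
  "partial_elementary L M A h \<longleftrightarrow>
     (\<forall>\<phi> e. wf_formula L \<phi> \<and> e ` free_vars \<phi> \<subseteq> A \<longrightarrow> (sat M e \<phi> \<longleftrightarrow> sat M (h \<circ> e) \<phi>))"

definition automorphism ::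
  "('f, 'r, 'z) language_scheme \<Rightarrow> ('f, 'r, 'a) fo_structure \<Rightarrow> ('a \<Rightarrow> 'a) \<Rightarrow> bool" where
  "automorphism L M \<sigma> \<longleftrightarrow> bij \<sigma> \<and>
     (\<forall>g xs. length xs = fun_arity L g \<longrightarrow>
        \<sigma> (fun_interp M g xs) = fun_interp M g (map \<sigma> xs)) \<and>
     (\<forall>R xs. length xs = rel_arity L R \<longrightarrow>
        (rel_interp M R xs \<longleftrightarrow> rel_interp M R (map \<sigma> xs)))"

definition strongly_homogeneous ::
  "('f, 'r, 'z) language_scheme \<Rightarrow> ('f, 'r, 'a) fo_structure \<Rightarrow> 'k rel \<Rightarrow> bool" where
  "strongly_homogeneous L M \<kappa> \<longleftrightarrow>
     (\<forall>A h. |A| <o \<kappa> \<and> partial_elementary L M A h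
        \<longrightarrow> (\<exists>\<sigma>. automorphism L M \<sigma> \<and> (\<forall>a \<in> A. \<sigma> a = h a)))"

text \<open>The complete theory of which \<open>M\<close> is a monster model is the theory of \<open>M\<close>. ``Large'' means
  larger than the number of formulas, so in particular uncountable.\<close>

definition monster_model ::
  "('f, 'r, 'z) language_scheme \<Rightarrow> ('f, 'r, 'a) fo_structure \<Rightarrow> 'k rel \<Rightarrow> bool" where
  "monster_model L M \<kappa> \<longleftrightarrow>
     Card_order \<kappa> \<and> |{\<phi> :: ('f, 'r) fo_formula. wf_formula L \<phi>}| <o \<kappa> \<and>
     saturated L M \<kappa> \<and> strongly_homogeneous L M \<kappa>"


section \<open>Valued fields\<close>

text \<open>Valuations are written additively, with \<open>v 0 = \<infinity>\<close>; \<open>Pinf\<close> is this \<open>\<infinity>\<close>, and the bottom element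
  of \<open>extended\<close> is never a value. The group \<open>'g\<close> is the value group, so \<open>v\<close> is onto.\<close>

definition valuation :: "('a::field \<Rightarrow> 'g::linordered_ab_group_add extended) \<Rightarrow> bool" where
  "valuation v \<longleftrightarrow>
     (\<forall>x. v x = Pinf \<longleftrightarrow> x = 0) \<and>
     range v = insert Pinf (range Fin) \<and>
     (\<forall>x y. v (x * y) = v x + v y) \<and>
     (\<forall>x y. min (v x) (v y) \<le> v (x + y))"

definition nontrivial_valuation ::
  "('a::field \<Rightarrow> 'g::linordered_ab_group_add extended) \<Rightarrow> bool" where
  "nontrivial_valuation v \<longleftrightarrow> valuation v \<and> (\<exists>x. x \<noteq> 0 \<and> v x \<noteq> 0)"

definition open_ball ::
  "('a::field \<Rightarrow> 'g::linordered_ab_group_add extended) \<Rightarrow> 'a \<Rightarrow> 'g \<Rightarrow> 'a set" where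
  "open_ball v a \<gamma> = {x. Fin \<gamma> < v (x - a)}"

definition closed_ball ::
  "('a::field \<Rightarrow> 'g::linordered_ab_group_add extended) \<Rightarrow> 'a \<Rightarrow> 'g \<Rightarrow> 'a set" where
  "closed_ball v a \<gamma> = {x. Fin \<gamma> \<le> v (x - a)}"

definition is_ball ::
  "('a::field \<Rightarrow> 'g::linordered_ab_group_add extended) \<Rightarrow> 'a set \<Rightarrow> bool" where
  "is_ball v B \<longleftrightarrow> (\<exists>a \<gamma>. B = open_ball v a \<gamma> \<or> B = closed_ball v a \<gamma>)"

definition valuation_topology ::
  "('a::field \<Rightarrow> 'g::linordered_ab_group_add extended) \<Rightarrow> 'a topology" where
  "valuation_topology v = topology_generated_by {open_ball v a \<gamma> | a \<gamma>. True}"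

definition has_val_deriv ::
  "('a::field \<Rightarrow> 'g::linordered_ab_group_add extended) \<Rightarrow> 'a set \<Rightarrow> ('a \<Rightarrow> 'a) \<Rightarrow> 'a \<Rightarrow> 'a \<Rightarrow> bool"
  where
  "has_val_deriv v B f a D \<longleftrightarrow>
     limitin (valuation_topology v) (\<lambda>x. (f x - f a) / (x - a)) D
       (atin_within (valuation_topology v) a B)"

definition val_differentiable_on ::
  "('a::field \<Rightarrow> 'g::linordered_ab_group_add extended) \<Rightarrow> 'a set \<Rightarrow> ('a \<Rightarrow> 'a) \<Rightarrow> bool" where
  "val_differentiable_on v B f \<longleftrightarrow> (\<forall>a \<in> B. \<exists>D. has_val_deriv v B f a D)"

definition val_deriv ::
  "('a::field \<Rightarrow> 'g::linordered_ab_group_add extended) \<Rightarrow> 'a set \<Rightarrow> ('a \<Rightarrow> 'a) \<Rightarrow> 'a \<Rightarrow> 'a" where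
  "val_deriv v B f a = (THE D. has_val_deriv v B f a D)"


section \<open>C-minimal expansions of ACVF\<close>

text \<open>A language extending the language of valued fields: among its symbols are the ring symbols and
  a binary relation symbol for divisibility, \<open>v x \<le> v y\<close>.\<close>

record ('f, 'r) valued_field_language = "('f, 'r) language" +
  zero_sym :: 'f
  one_sym :: 'f
  add_sym :: 'f
  neg_sym :: 'f
  mult_sym :: 'f
  div_sym :: 'r

definition expands_valued_field ::
  "('f, 'r) valued_field_language \<Rightarrow> ('f, 'r, 'a) fo_structure \<Rightarrow>
     ('a::field \<Rightarrow> 'g::linordered_ab_group_add extended) \<Rightarrow> bool" where
  "expands_valued_field L M v \<longleftrightarrow>
     fun_arity L (zero_sym L) = 0 \<and> fun_interp M (zero_sym L) [] = 0 \<and>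
     fun_arity L (one_sym L) = 0 \<and> fun_interp M (one_sym L) [] = 1 \<and>
     fun_arity L (add_sym L) = 2 \<and> (\<forall>x y. fun_interp M (add_sym L) [x, y] = x + y) \<and>
     fun_arity L (neg_sym L) = 1 \<and> (\<forall>x. fun_interp M (neg_sym L) [x] = - x) \<and>
     fun_arity L (mult_sym L) = 2 \<and> (\<forall>x y. fun_interp M (mult_sym L) [x, y] = x * y) \<and>
     rel_arity L (div_sym L) = 2 \<and> (\<forall>x y. rel_interp M (div_sym L) [x, y] \<longleftrightarrow> v x \<le> v y)"

text \<open>Being algebraically closed is imposed by the type class of the universe.\<close>

definition expands_ACVF ::
  "('f, 'r) valued_field_language \<Rightarrow> ('f, 'r, 'a) fo_structure \<Rightarrow>
     ('a::alg_closed_field \<Rightarrow> 'g::linordered_ab_group_add extended) \<Rightarrow> bool" where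
  "expands_ACVF L M v \<longleftrightarrow> nontrivial_valuation v \<and> expands_valued_field L M v"

inductive_set ball_point_combinations ::
  "('a::field \<Rightarrow> 'g::linordered_ab_group_add extended) \<Rightarrow> 'a set set"
  for v :: "'a \<Rightarrow> 'g extended" where
  ball: "is_ball v B \<Longrightarrow> B \<in> ball_point_combinations v"
| point: "{a} \<in> ball_point_combinations v"
| complement: "X \<in> ball_point_combinations v \<Longrightarrow> - X \<in> ball_point_combinations v"
| union: "X \<in> ball_point_combinations v \<Longrightarrow> Y \<in> ball_point_combinations v \<Longrightarrow>
            X \<union> Y \<in> ball_point_combinations v"

text \<open>For a theory, C-minimality is asked of all its models. For the theory of a monster model \<open>M\<close>
  this follows from C-minimality of \<open>M\<close>, because saturation bounds the number of balls and points
  needed uniformly in definable families.\<close>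

definition C_minimal ::
  "('f, 'r) valued_field_language \<Rightarrow> ('f, 'r, 'a) fo_structure \<Rightarrow>
     ('a::field \<Rightarrow> 'g::linordered_ab_group_add extended) \<Rightarrow> bool" where
  "C_minimal L M v \<longleftrightarrow> (\<forall>X. definable_set L M X \<longrightarrow> X \<in> ball_point_combinations v)"

end

theory Submission
  imports Defs
begin

text \<open>The boundary of a boolean combination of balls and points is finite, so an infinite definable
  set contains a ball; and by saturation the union of a definable chain of finite sets is finite.
  For a fixed precision \<open>\<epsilon>\<close>, the points \<open>a\<close> without an \<open>\<epsilon>\<close>-approximate strict derivative are the
  union over \<open>d\<close> of the sets of those at which \<open>f\<close> is linear up to \<open>\<epsilon>\<close> on the ball of radius \<open>v d\<close>.
  If such a set contained a ball, comparing the linear approximations at any two of its points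
  would yield an \<open>\<epsilon>\<close>-approximate strict derivative there. So each of them is finite, hence so is
  their union, and then the union of these unions over all \<open>\<epsilon>\<close>.\<close>

section \<open>Valuations\<close>

lemma Fin_max_less_iff: "Fin (max a b :: 'g::linorder) < c \<longleftrightarrow> Fin a < c \<and> Fin b < c"
  by (cases c) auto

lemma valuation_zero_iff: "valuation v \<Longrightarrow> v x = Pinf \<longleftrightarrow> x = 0"
  by (simp add: valuation_def)

lemma valuation_Fin:
  assumes "valuation v" "x \<noteq> 0"
  obtains g where "v x = Fin g"
proof -
  have "v x \<in> insert Pinf (range Fin)"
    using assms(1) unfolding valuation_def by blast
  then show thesis
    using assms that by (auto simp: valuation_zero_iff)
qed

lemma valuation_surj:
  assumes "valuation v"
  obtains x where "x \<noteq> 0" "v x = Fin g"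
proof -
  have "Fin g \<in> range v"
    using assms unfolding valuation_def by blast
  then obtain x where "v x = Fin g"
    by (metis imageE)
  moreover have "x \<noteq> 0"
    using calculation assms valuation_zero_iff[of v x] by auto
  ultimately show thesis
    using that by blast
qed

lemma valuation_mult: "valuation v \<Longrightarrow> v (x * y) = v x + v y"
  by (simp add: valuation_def)

lemma valuation_add_ge:
  assumes "valuation v" "c \<le> v x" "c \<le> v y"
  shows "c \<le> v (x + y)"
proof -
  have "min (v x) (v y) \<le> v (x + y)"
    using assms(1) by (simp add: valuation_def)
  then show ?thesis
    using assms(2,3) by (meson min.boundedI order_trans)
qed

lemma valuation_add_gt:
  assumes "valuation v" "c < v x" "c < v y"
  shows "c < v (x + y)"
proof -
  have "min (v x) (v y) \<le> v (x + y)"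
    using assms(1) by (simp add: valuation_def)
  then show ?thesis
    using assms(2,3) by (metis min_less_iff_conj order_less_le_trans)
qed

lemma valuation_one:
  assumes "valuation v"
  shows "v 1 = Fin 0"
proof -
  obtain g where g: "v 1 = Fin g"
    using valuation_Fin[OF assms, of 1] by auto
  have "v (1 * 1) = v 1 + v 1"
    by (rule valuation_mult[OF assms])
  then have "g = g + g"
    using g by simp
  then show ?thesis
    using g by simp
qed

lemma valuation_minus:
  assumes "valuation v"
  shows "v (- x) = v x"
proof -
  obtain g where g: "v (- 1) = Fin g"
    using valuation_Fin[OF assms, of "- 1"] by auto
  have "v ((- 1) * (- 1)) = v (- 1) + v (- 1)"
    by (rule valuation_mult[OF assms])
  then have "g + g = 0"
    using g valuation_one[OF assms] by simp
  \<comment> \<open>A linearly ordered group has no torsion.\<close>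
  then have "g = 0"
    by simp
  moreover have "v ((- 1) * x) = v (- 1) + v x"
    by (rule valuation_mult[OF assms])
  ultimately show ?thesis
    using g by (cases "v x") auto
qed

lemma valuation_minus_commute:
  assumes "valuation v"
  shows "v (x - y) = v (y - x)"
  using valuation_minus[OF assms, of "x - y"] by simp

lemma valuation_diff_ge:
  assumes "valuation v" "c \<le> v x" "c \<le> v y"
  shows "c \<le> v (x - y)"
  using valuation_add_ge[of v c x "- y"] assms by (simp add: valuation_minus)

lemma valuation_mult_le_cancel:
  assumes "valuation v" "z \<noteq> 0"
  shows "v (x * z) \<le> v (y * z) \<longleftrightarrow> v x \<le> v y"
proof -
  obtain g where "v z = Fin g"
    using valuation_Fin[OF assms] .
  then show ?thesis
    by (cases "v x"; cases "v y") (auto simp: valuation_mult[OF assms(1)])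
qed

lemma valuation_mult_mono:
  assumes "valuation v" "v x \<le> v y"
  shows "v (x * z) \<le> v (y * z)"
  using assms by (cases "z = 0") (auto simp: valuation_mult_le_cancel)

text \<open>A nontrivial value group has no largest element: adding a positive value to
  \<open>g\<close> gives a larger one, and \<open>v\<close> is onto. This supplies small radii and
  precisions as nonzero field elements.\<close>

lemma valuation_greater:
  assumes "nontrivial_valuation v"
  obtains x where "x \<noteq> 0" "Fin g < v x"
proof -
  have val: "valuation v"
    using assms by (simp add: nontrivial_valuation_def)
  obtain y where y: "y \<noteq> 0" "v y \<noteq> 0"
    using assms by (auto simp: nontrivial_valuation_def)
  obtain h where h: "v y = Fin h"
    using valuation_Fin[OF val y(1)] .
  then have "h \<noteq> 0"
    using y(2) by (auto simp: zero_extended_def)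
  then have "0 < max h (- h)"
    by (auto simp: less_max_iff_disj neq_iff)
  moreover obtain x where "x \<noteq> 0" "v x = Fin (g + max h (- h))"
    using valuation_surj[OF val] .
  ultimately show thesis
    using that by simp
qed

section \<open>The valuation topology\<close>

lemma open_ball_recenter:
  assumes "valuation v" "x \<in> open_ball v a \<gamma>"
  shows "open_ball v x \<gamma> = open_ball v a \<gamma>"
proof -
  have "Fin \<gamma> < v (y - x) \<longleftrightarrow> Fin \<gamma> < v (y - a)" for y
    using valuation_add_gt[OF assms(1), of "Fin \<gamma>" "y - x" "x - a"]
      valuation_add_gt[OF assms(1), of "Fin \<gamma>" "y - a" "a - x"] assms(2)
      valuation_minus_commute[OF assms(1), of a x]
    by (auto simp: open_ball_def)
  then show ?thesis
    by (auto simp: open_ball_def)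
qed

lemma open_ball_nhd:
  "valuation v \<Longrightarrow> x \<in> open_ball v a \<gamma> \<Longrightarrow> \<exists>\<delta>. open_ball v x \<delta> \<subseteq> open_ball v a \<gamma>"
  by (rule exI[of _ \<gamma>]) (simp add: open_ball_recenter)

lemma open_ball_center: "valuation v \<Longrightarrow> a \<in> open_ball v a \<gamma>"
  using valuation_zero_iff[of v 0] by (simp add: open_ball_def)

lemma open_ball_antimono: "\<gamma> \<le> \<delta> \<Longrightarrow> open_ball v a \<delta> \<subseteq> open_ball v a \<gamma>"
  by (auto simp: open_ball_def intro: order_le_less_trans[of "Fin \<gamma>" "Fin \<delta>"])

text \<open>Balls about a common centre are nested and every point of an open ball is a centre of
  it. So the generating balls already form a base, and those about \<open>x\<close> a neighbourhood
  base at \<open>x\<close>.\<close>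

lemma openin_valuation_topology:
  fixes v :: "'a::field \<Rightarrow> 'g::linordered_ab_group_add extended"
  assumes "valuation v"
  shows "openin (valuation_topology v) U \<longleftrightarrow> (\<forall>x\<in>U. \<exists>\<gamma>. open_ball v x \<gamma> \<subseteq> U)"
proof
  assume "openin (valuation_topology v) U"
  then have "generate_topology_on {open_ball v a \<gamma> | a \<gamma>. True} U"
    by (simp add: valuation_topology_def openin_topology_generated_by_iff)
  then show "\<forall>x\<in>U. \<exists>\<gamma>. open_ball v x \<gamma> \<subseteq> U"
  proof induction
    case (Int U V)
    show ?case
    proof
      fix x assume "x \<in> U \<inter> V"
      then obtain \<gamma> \<delta> where "open_ball v x \<gamma> \<subseteq> U" "open_ball v x \<delta> \<subseteq> V"
        using Int.IH by blast
      then have "open_ball v x (max \<gamma> \<delta>) \<subseteq> U \<inter> V"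
        using open_ball_antimono[of \<gamma> "max \<gamma> \<delta>" v x] open_ball_antimono[of \<delta> "max \<gamma> \<delta>" v x]
        by (metis Int_greatest max.cobounded1 max.cobounded2 subset_trans)
      then show "\<exists>\<gamma>. open_ball v x \<gamma> \<subseteq> U \<inter> V" ..
    qed
  next
    case (UN K)
    then show ?case
      by (meson Union_upper UnionE subset_trans)
  next
    case (Basis U)
    then show ?case
      using open_ball_nhd[OF assms] by auto
  qed auto
next
  assume U: "\<forall>x\<in>U. \<exists>\<gamma>. open_ball v x \<gamma> \<subseteq> U"
  let ?\<B> = "{open_ball v a \<gamma> | a \<gamma>. open_ball v a \<gamma> \<subseteq> U}"
  have "U = \<Union> ?\<B>"
  proof
    show "U \<subseteq> \<Union> ?\<B>"
    proof
      fix x assume "x \<in> U"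
      then obtain \<gamma> where "open_ball v x \<gamma> \<subseteq> U"
        using U by blast
      then have "open_ball v x \<gamma> \<in> ?\<B>"
        by blast
      then show "x \<in> \<Union> ?\<B>"
        using open_ball_center[OF assms] by (rule UnionI)
    qed
  qed blast
  moreover have "openin (valuation_topology v) (\<Union> ?\<B>)"
    unfolding valuation_topology_def
    by (rule openin_Union) (auto intro!: topology_generated_by_Basis)
  ultimately show "openin (valuation_topology v) U"
    by simp
qed

lemma openin_open_ball: "valuation v \<Longrightarrow> openin (valuation_topology v) (open_ball v a \<gamma>)"
  by (simp add: openin_valuation_topology open_ball_nhd)

lemma topspace_valuation_topology: "valuation v \<Longrightarrow> topspace (valuation_topology v) = UNIV"
  using openin_subset[of "valuation_topology v" UNIV] openin_valuation_topology[of v UNIV] by auto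

lemma limitin_valuation_topology:
  assumes "valuation v"
  shows "limitin (valuation_topology v) g l F \<longleftrightarrow> (\<forall>\<gamma>. \<forall>\<^sub>F x in F. Fin \<gamma> < v (g x - l))"
proof
  assume "limitin (valuation_topology v) g l F"
  then have "\<forall>\<^sub>F x in F. g x \<in> open_ball v l \<gamma>" for \<gamma>
    using openin_open_ball[OF assms] open_ball_center[OF assms] by (auto simp: limitin_def)
  then show "\<forall>\<gamma>. \<forall>\<^sub>F x in F. Fin \<gamma> < v (g x - l)"
    by (simp add: open_ball_def)
next
  assume *: "\<forall>\<gamma>. \<forall>\<^sub>F x in F. Fin \<gamma> < v (g x - l)"
  have "\<forall>\<^sub>F x in F. g x \<in> U" if U: "openin (valuation_topology v) U" "l \<in> U" for U
  proof -
    obtain \<gamma> where \<gamma>: "open_ball v l \<gamma> \<subseteq> U"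
      using U openin_valuation_topology[OF assms] by blast
    have "\<forall>\<^sub>F x in F. Fin \<gamma> < v (g x - l)"
      using * by blast
    then show ?thesis
      by (rule eventually_mono) (use \<gamma> in \<open>auto simp: open_ball_def\<close>)
  qed
  then show "limitin (valuation_topology v) g l F"
    by (simp add: limitin_def topspace_valuation_topology[OF assms])
qed

lemma eventually_atin_valuation_topology:
  assumes "valuation v"
  shows "eventually P (atin_within (valuation_topology v) a S) \<longleftrightarrow>
    (\<exists>\<gamma>. \<forall>x\<in>S. x \<noteq> a \<and> Fin \<gamma> < v (x - a) \<longrightarrow> P x)"
proof
  assume "eventually P (atin_within (valuation_topology v) a S)"
  then obtain U where U: "openin (valuation_topology v) U" "a \<in> U" "\<forall>x\<in>U. x \<in> S \<and> x \<noteq> a \<longrightarrow> P x"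
    by (auto simp: eventually_atin_within topspace_valuation_topology[OF assms])
  then obtain \<gamma> where "open_ball v a \<gamma> \<subseteq> U"
    using openin_valuation_topology[OF assms] by blast
  then show "\<exists>\<gamma>. \<forall>x\<in>S. x \<noteq> a \<and> Fin \<gamma> < v (x - a) \<longrightarrow> P x"
    using U(3) by (auto simp: open_ball_def)
next
  assume "\<exists>\<gamma>. \<forall>x\<in>S. x \<noteq> a \<and> Fin \<gamma> < v (x - a) \<longrightarrow> P x"
  then obtain \<gamma> where "\<forall>x\<in>open_ball v a \<gamma>. x \<in> S \<and> x \<noteq> a \<longrightarrow> P x"
    by (auto simp: open_ball_def)
  then show "eventually P (atin_within (valuation_topology v) a S)"
    unfolding eventually_atin_within
    using openin_open_ball[OF assms] open_ball_center[OF assms]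
    by (intro disjI2 exI[of _ "open_ball v a \<gamma>"]) simp
qed

text \<open>Moving a point by less than the radius of \<open>B\<close> cannot carry it across the
  edge of \<open>B\<close>, by the ultrametric inequality. So the radius of \<open>B\<close> itself
  works for every \<open>x\<close>, and balls have no boundary points.\<close>

lemma is_ball_clopen:
  assumes "valuation v" "is_ball v B"
  shows "\<exists>\<gamma>. open_ball v x \<gamma> \<subseteq> B \<or> open_ball v x \<gamma> \<subseteq> - B"
proof -
  obtain a \<gamma> where B: "B = open_ball v a \<gamma> \<or> B = closed_ball v a \<gamma>"
    using assms(2) by (auto simp: is_ball_def)
  have eq: "c \<le> v (y - a) \<longleftrightarrow> c \<le> v (x - a)" if "c \<le> v (y - x)" for c y
    using valuation_add_ge[OF assms(1), of c "y - x" "x - a"]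
      valuation_diff_ge[OF assms(1), of c "y - a" "y - x"] that by auto
  have eq': "c < v (y - a) \<longleftrightarrow> c < v (x - a)" if "c < v (y - x)" for c y
    using valuation_add_gt[OF assms(1), of c "y - x" "x - a"]
      valuation_add_gt[OF assms(1), of c "y - a" "x - y"] that
      valuation_minus_commute[OF assms(1), of x y] by auto
  have "open_ball v x \<gamma> \<subseteq> B \<or> open_ball v x \<gamma> \<subseteq> - B"
    using B eq[of "Fin \<gamma>"] eq'[of "Fin \<gamma>"]
    unfolding open_ball_def closed_ball_def by (metis (mono_tags, lifting) ComplI mem_Collect_eq order_less_imp_le subsetI)
  then show ?thesis ..
qed

section \<open>C-minimality\<close>

text \<open>The set in question is the topological boundary of \<open>X\<close>. It is empty for a
  ball and at most the point itself for a point; complements preserve it, and the boundary of a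
  union lies in the union of the boundaries.\<close>

lemma ball_point_combination_boundary_finite:
  fixes v :: "'a::field \<Rightarrow> 'g::linordered_ab_group_add extended"
  assumes val: "valuation v" and "X \<in> ball_point_combinations v"
  shows "finite {x. \<not> (\<exists>\<gamma>. open_ball v x \<gamma> \<subseteq> X \<or> open_ball v x \<gamma> \<subseteq> - X)}"
  using assms(2)
proof induction
  case (ball B)
  then show ?case
    using is_ball_clopen[OF val] by simp
next
  case (point a)
  have "\<exists>\<gamma>. open_ball v x \<gamma> \<subseteq> - {a}" if "x \<noteq> a" for x
  proof -
    have "a - x \<noteq> 0"
      using that by simp
    then obtain g where "v (a - x) = Fin g"
      by (rule valuation_Fin[OF val])
    then have "open_ball v x g \<subseteq> - {a}"
      by (auto simp: open_ball_def)
    then show ?thesis ..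
  qed
  then have "{x. \<not> (\<exists>\<gamma>. open_ball v x \<gamma> \<subseteq> {a} \<or> open_ball v x \<gamma> \<subseteq> - {a})} \<subseteq> {a}"
    by blast
  then show ?case
    by (rule finite_subset) simp
next
  case (complement X)
  then show ?case
    by (simp add: disj_commute)
next
  case (union X Y)
  let ?bd = "\<lambda>X. {x. \<not> (\<exists>\<gamma>. open_ball v x \<gamma> \<subseteq> X \<or> open_ball v x \<gamma> \<subseteq> - X)}"
  have "?bd (X \<union> Y) \<subseteq> ?bd X \<union> ?bd Y"
  proof
    fix x assume x: "x \<in> ?bd (X \<union> Y)"
    show "x \<in> ?bd X \<union> ?bd Y"
    proof (rule ccontr)
      assume "x \<notin> ?bd X \<union> ?bd Y"
      then obtain \<gamma> \<delta> where
        "open_ball v x \<gamma> \<subseteq> X \<or> open_ball v x \<gamma> \<subseteq> - X"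
        "open_ball v x \<delta> \<subseteq> Y \<or> open_ball v x \<delta> \<subseteq> - Y"
        by blast
      moreover have "open_ball v x (max \<gamma> \<delta>) \<subseteq> open_ball v x \<gamma>"
        "open_ball v x (max \<gamma> \<delta>) \<subseteq> open_ball v x \<delta>"
        by (simp_all add: open_ball_antimono)
      ultimately have "open_ball v x (max \<gamma> \<delta>) \<subseteq> X \<union> Y \<or> open_ball v x (max \<gamma> \<delta>) \<subseteq> - (X \<union> Y)"
        by blast
      then show False
        using x by blast
    qed
  qed
  then show ?case
    using union.IH by (meson finite_UnI finite_subset)
qed

text \<open>An infinite set has a point off its finite boundary. Some ball about that point is
  inside the set or inside its complement, and its centre excludes the latter.\<close>

lemma infinite_ball_point_combination_contains_ball:
  assumes "valuation v" "X \<in> ball_point_combinations v" "infinite X"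
  obtains a \<gamma> where "open_ball v a \<gamma> \<subseteq> X"
proof -
  have "\<not> X \<subseteq> {x. \<not> (\<exists>\<gamma>. open_ball v x \<gamma> \<subseteq> X \<or> open_ball v x \<gamma> \<subseteq> - X)}"
    using ball_point_combination_boundary_finite[OF assms(1,2)] assms(3) finite_subset by blast
  then obtain a \<gamma> where "a \<in> X" "open_ball v a \<gamma> \<subseteq> X \<or> open_ball v a \<gamma> \<subseteq> - X"
    by blast
  then show thesis
    using that open_ball_center[OF assms(1), of a \<gamma>] by blast
qed

text \<open>Trades the one-element lists of the definition for updates of variable 0, the form in
  which the formulas below are evaluated.\<close>

lemma definable_setI:
  assumes "wf_formula L \<phi>" "\<And>x. x \<in> X \<longleftrightarrow> sat M (e(0 := x)) \<phi>"
  shows "definable_set L M X"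
proof -
  have "(\<lambda>i. if i < 1 then xs ! i else e i) = e(0 := xs ! 0)" for xs
    by auto
  then have "{[x] | x. x \<in> X} = {xs. length xs = 1 \<and> sat M (\<lambda>i. if i < 1 then xs ! i else e i) \<phi>}"
    by (auto simp: assms(2) length_Suc_conv)
  then show ?thesis
    unfolding definable_set_def definable_def using assms(1) by blast
qed

section \<open>Renaming of variables\<close>

primrec rename_term :: "(nat \<Rightarrow> nat) \<Rightarrow> 'f fo_term \<Rightarrow> 'f fo_term" where
  "rename_term \<sigma> (Var n) = Var (\<sigma> n)"
| "rename_term \<sigma> (App g ts) = App g (map (rename_term \<sigma>) ts)"

text \<open>Bound variables are renamed together with free ones, so no fresh variables have to be
  chosen; injectivity of the renaming then rules out capture.\<close>

primrec rename_formula :: "(nat \<Rightarrow> nat) \<Rightarrow> ('f, 'r) fo_formula \<Rightarrow> ('f, 'r) fo_formula" where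
  "rename_formula \<sigma> (Eq s u) = Eq (rename_term \<sigma> s) (rename_term \<sigma> u)"
| "rename_formula \<sigma> (Rel R ts) = Rel R (map (rename_term \<sigma>) ts)"
| "rename_formula \<sigma> (Neg \<phi>) = Neg (rename_formula \<sigma> \<phi>)"
| "rename_formula \<sigma> (Conj \<phi> \<psi>) = Conj (rename_formula \<sigma> \<phi>) (rename_formula \<sigma> \<psi>)"
| "rename_formula \<sigma> (Exi n \<phi>) = Exi (\<sigma> n) (rename_formula \<sigma> \<phi>)"

lemma wf_rename_term: "wf_term L (rename_term \<sigma> s) = wf_term L s"
  by (induction s) auto

lemma wf_rename_formula: "wf_formula L (rename_formula \<sigma> \<phi>) = wf_formula L \<phi>"
  by (induction \<phi>) (auto simp: wf_rename_term)

lemma eval_rename_term: "eval_term M e (rename_term \<sigma> s) = eval_term M (e \<circ> \<sigma>) s"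
  by (induction s) (auto intro!: arg_cong[where f = "fun_interp M _"])

lemma sat_rename_formula:
  assumes "inj \<sigma>"
  shows "sat M e (rename_formula \<sigma> \<phi>) = sat M (e \<circ> \<sigma>) \<phi>"
proof (induction \<phi> arbitrary: e)
  case (Rel R ts)
  then show ?case
    by (auto simp: eval_rename_term comp_def)
next
  case (Exi n \<phi>)
  \<comment> \<open>By injectivity no other variable is sent to \<open>\<sigma> n\<close>, so the
    quantifier affects only \<open>n\<close>.\<close>
  have "e(\<sigma> n := x) \<circ> \<sigma> = (e \<circ> \<sigma>)(n := x)" for x
    using assms by (auto simp: fun_eq_iff inj_def)
  then show ?case
    by (simp only: sat.simps rename_formula.simps Exi.IH)
qed (auto simp: eval_rename_term)

section \<open>Saturation\<close>

lemma infinite_wf_formulas: "infinite {\<phi>. wf_formula L \<phi>}"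
proof
  assume "finite {\<phi>. wf_formula L \<phi>}"
  moreover have "range (\<lambda>n. Eq (Var n) (Var n)) \<subseteq> {\<phi>. wf_formula L \<phi>}"
    by auto
  moreover have "inj (\<lambda>n. Eq (Var n) (Var n))"
    by (simp add: inj_def)
  ultimately show False
    using range_inj_infinite finite_subset by blast
qed

text \<open>There are infinitely many formulas, because there are infinitely many variables;
  \<open>\<kappa>\<close> exceeds their number and is therefore uncountable.\<close>

lemma monster_model_countable:
  assumes "monster_model L M \<kappa>" "countable A"
  shows "|A| <o \<kappa>"
proof -
  let ?F = "{\<phi>. wf_formula L \<phi>}"
  have "|A| \<le>o |UNIV :: nat set|"
    using assms(2) by (meson countableE card_of_ordLeq subset_UNIV)
  also have "|UNIV :: nat set| \<le>o |?F|"
    using infinite_wf_formulas infinite_iff_card_of_nat by blast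
  finally have "|A| \<le>o |?F|" .
  then show ?thesis
    using assms(1) ordLeq_ordLess_trans unfolding monster_model_def by blast
qed

text \<open>A countably infinite subset of the union would, by saturation, be contained in a single member
  of the chain.\<close>

lemma monster_model_chain_finite:
  assumes mon: "monster_model L M \<kappa>"
    and wf: "wf_formula L \<phi>"
    and fin: "\<And>z. finite {x. sat M (p(0 := x, 1 := z)) \<phi>}"
    and chain: "\<And>z z'. (\<forall>x. sat M (p(0 := x, 1 := z)) \<phi> \<longrightarrow> sat M (p(0 := x, 1 := z')) \<phi>) \<or>
                (\<forall>x. sat M (p(0 := x, 1 := z')) \<phi> \<longrightarrow> sat M (p(0 := x, 1 := z)) \<phi>)"
  shows "finite {x. \<exists>z. sat M (p(0 := x, 1 := z)) \<phi>}"
proof (rule ccontr)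
  assume "infinite {x. \<exists>z. sat M (p(0 := x, 1 := z)) \<phi>}"
  from infinite_countable_subset[OF this] obtain c :: "nat \<Rightarrow> _" where
    c: "inj c" "range c \<subseteq> {x. \<exists>z. sat M (p(0 := x, 1 := z)) \<phi>}"
    by (elim exE conjE)
  \<comment> \<open>A type is realized in variable 0, but the chain index \<open>z\<close> to be
    found is variable 1. Hence the two are swapped.\<close>
  define \<sigma> :: "nat \<Rightarrow> nat" where "\<sigma> = id(0 := 1, 1 := 0)"
  define \<psi> where "\<psi> = rename_formula \<sigma> \<phi>"
  have "inj \<sigma>"
    by (auto simp: \<sigma>_def inj_def split: if_splits)
  moreover have "p(1 := x, 0 := z) \<circ> \<sigma> = p(0 := x, 1 := z)" for x z
    by (auto simp: \<sigma>_def fun_eq_iff)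
  ultimately have \<psi>: "sat M (p(1 := x, 0 := z)) \<psi> = sat M (p(0 := x, 1 := z)) \<phi>" for x z
    by (simp add: \<psi>_def sat_rename_formula)
  \<comment> \<open>This type says of an index that its member of the chain contains every
    \<open>c n\<close>.\<close>
  define q where "q = range (\<lambda>n. (\<psi>, p(1 := c n)))"
  have real: "realizes M z ((\<lambda>n. (\<psi>, p(1 := c n))) ` N) \<longleftrightarrow> (\<forall>n\<in>N. sat M (p(0 := c n, 1 := z)) \<phi>)"
    for z N
    using \<psi> by (simp add: realizes_def)
  \<comment> \<open>Finite satisfiability: finitely many points of the union of a chain lie together
    in one member, the largest of those containing them singly.\<close>
  have "\<exists>z. \<forall>n\<in>N. sat M (p(0 := c n, 1 := z)) \<phi>" if "finite N" for N
    using that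
  proof induction
    case (insert m N)
    then obtain z where "\<forall>n\<in>N. sat M (p(0 := c n, 1 := z)) \<phi>"
      by blast
    moreover obtain z' where "sat M (p(0 := c m, 1 := z')) \<phi>"
      using c(2) by blast
    ultimately show ?case
      using chain[of z z'] by (metis insert_iff)
  qed simp
  then have "\<forall>q'\<subseteq>q. finite q' \<longrightarrow> (\<exists>z. realizes M z q')"
    unfolding q_def using finite_subset_image real by (metis (no_types, lifting))
  \<comment> \<open>An environment has countable range, its variables being numbers, so the
    parameters of \<open>q\<close> come from a countable set.\<close>
  moreover have "|range p \<union> range c| <o \<kappa>"
    using mon by (rule monster_model_countable) simp
  moreover have "\<forall>(\<chi>, e) \<in> q. wf_formula L \<chi> \<and> e ` (free_vars \<chi> - {0}) \<subseteq> range p \<union> range c"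
    using wf by (auto simp: q_def \<psi>_def wf_rename_formula)
  ultimately obtain z where "realizes M z q"
    using mon unfolding monster_model_def saturated_def by meson
  then have "range c \<subseteq> {x. sat M (p(0 := x, 1 := z)) \<phi>}"
    using real[of z UNIV] by (auto simp: q_def)
  then show False
    using fin[of z] c(1) finite_subset range_inj_infinite by blast
qed

section \<open>Difference quotients up to a given precision\<close>

text \<open>Radius and precision are given by field elements \<open>d\<close> and
  \<open>\<epsilon>\<close>, since formulas quantify over the field only. Clearing the denominator
  makes the condition hold trivially at \<open>x = a\<close>.\<close>

definition approx_diff ::
  "('a::field \<Rightarrow> 'g::linordered_ab_group_add extended) \<Rightarrow> 'a set \<Rightarrow> ('a \<Rightarrow> 'a) \<Rightarrow> 'a \<Rightarrow> 'a \<Rightarrow> 'a \<Rightarrow> bool"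
  where
  "approx_diff v B f \<epsilon> d a \<longleftrightarrow>
     (\<exists>D. \<forall>x\<in>B. v d \<le> v (x - a) \<longrightarrow> v (\<epsilon> * (x - a)) \<le> v (f x - f a - D * (x - a)))"

text \<open>For \<open>d = 0\<close> the ball would shrink to \<open>a\<close> and the condition
  would be empty, hence the clause \<open>d \<noteq> 0\<close>; \<open>approx_diff\<close> leaves
  this clause to the places that use it.\<close>

definition approx_strict_diff ::
  "('a::field \<Rightarrow> 'g::linordered_ab_group_add extended) \<Rightarrow> 'a set \<Rightarrow> ('a \<Rightarrow> 'a) \<Rightarrow> 'a \<Rightarrow> 'a \<Rightarrow> bool"
  where
  "approx_strict_diff v B f \<epsilon> a \<longleftrightarrow>
     (\<exists>D d. d \<noteq> 0 \<and> (\<forall>x\<in>B. \<forall>y\<in>B. v d \<le> v (x - a) \<and> v d \<le> v (y - a) \<longrightarrow>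
        v (\<epsilon> * (x - y)) \<le> v (f x - f y - D * (x - y))))"

lemma diff_quotient_mult: "z \<noteq> 0 \<Longrightarrow> (q / z - D) * z = q - D * z" for z :: "'a::field"
  by (simp add: left_diff_distrib)

text \<open>A larger value of \<open>d\<close> means a smaller ball. This makes the sets indexed by
  \<open>d\<close> a chain.\<close>

lemma approx_diff_mono:
  "v d \<le> v d' \<Longrightarrow> approx_diff v B f \<epsilon> d a \<Longrightarrow> approx_diff v B f \<epsilon> d' a"
  unfolding approx_diff_def by (meson order_trans)

text \<open>A coarser precision is easier to attain. This makes the exceptional sets indexed by
  \<open>\<epsilon>\<close> a chain.\<close>

lemma approx_strict_diff_antimono:
  assumes "valuation v" "v \<epsilon> \<le> v \<epsilon>'" "approx_strict_diff v B f \<epsilon>' a"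
  shows "approx_strict_diff v B f \<epsilon> a"
  using assms(3) valuation_mult_mono[OF assms(1,2)]
  unfolding approx_strict_diff_def by (meson order_trans)

text \<open>Shows that the sets indexed by \<open>d\<close> exhaust the points of differentiability:
  the bound on the quotient, multiplied by \<open>x - a\<close>, is the bound in
  \<open>approx_diff\<close>.\<close>

lemma approx_diff_exists:
  assumes "nontrivial_valuation v" "\<epsilon> \<noteq> 0" "has_val_deriv v B f a D"
  obtains d where "d \<noteq> 0" "approx_diff v B f \<epsilon> d a"
proof -
  have val: "valuation v"
    using assms(1) by (simp add: nontrivial_valuation_def)
  obtain g where g: "v \<epsilon> = Fin g"
    using valuation_Fin[OF val assms(2)] .
  have "\<forall>\<^sub>F x in atin_within (valuation_topology v) a B. Fin g < v ((f x - f a) / (x - a) - D)"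
    using assms(3) by (simp add: has_val_deriv_def limitin_valuation_topology[OF val])
  then obtain \<gamma> where \<gamma>: "\<And>x. x \<in> B \<Longrightarrow> x \<noteq> a \<Longrightarrow> Fin \<gamma> < v (x - a) \<Longrightarrow>
      Fin g < v ((f x - f a) / (x - a) - D)"
    by (auto simp: eventually_atin_valuation_topology[OF val])
  \<comment> \<open>The closed ball of radius \<open>v d\<close> lies in the open one of radius
    \<open>\<gamma>\<close>.\<close>
  obtain d where d: "d \<noteq> 0" "Fin \<gamma> < v d"
    using valuation_greater[OF assms(1)] .
  have "v (\<epsilon> * (x - a)) \<le> v (f x - f a - D * (x - a))" if "x \<in> B" "v d \<le> v (x - a)" for x
  proof (cases "x = a")
    case True
    then show ?thesis
      by simp
  next
    case False
    have "v \<epsilon> \<le> v ((f x - f a) / (x - a) - D)"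
      using \<gamma>[of x] False that d g by (simp add: order_less_imp_le order_less_le_trans)
    then have "v (\<epsilon> * (x - a)) \<le> v (((f x - f a) / (x - a) - D) * (x - a))"
      by (rule valuation_mult_mono[OF val])
    then show ?thesis
      using False by (simp add: diff_quotient_mult)
  qed
  then show thesis
    using that d(1) unfolding approx_diff_def by blast
qed

text \<open>Comparing the difference quotient of a pair of points with the approximate derivatives at both
  of them shows that the latter agree up to \<open>\<epsilon>\<close>.\<close>

lemma approx_strict_diffI:
  assumes nt: "nontrivial_valuation v" and "d \<noteq> 0"
    and ball: "\<And>x. x \<in> open_ball v a \<gamma> \<Longrightarrow> x \<in> B \<and> approx_diff v B f \<epsilon> d x"
  shows "approx_strict_diff v B f \<epsilon> a"
proof -
  have val: "valuation v"
    using nt by (simp add: nontrivial_valuation_def)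
  obtain k where k: "v d = Fin k"
    using valuation_Fin[OF val \<open>d \<noteq> 0\<close>] .
  \<comment> \<open>The new radius must keep points inside the given ball and also within the common
    radius \<open>v d\<close> of each other.\<close>
  obtain d' where "d' \<noteq> 0" "Fin (max \<gamma> k) < v d'"
    using valuation_greater[OF nt] .
  then have d': "d' \<noteq> 0" "Fin \<gamma> < v d'" "v d \<le> v d'"
    using k Fin_max_less_iff[of \<gamma> k "v d'"] by auto
  have "\<forall>x\<in>open_ball v a \<gamma>. \<exists>D. \<forall>y\<in>B. v d \<le> v (y - x) \<longrightarrow>
      v (\<epsilon> * (y - x)) \<le> v (f y - f x - D * (y - x))"
    using ball by (simp add: approx_diff_def)
  then obtain D where D: "\<And>x y. x \<in> open_ball v a \<gamma> \<Longrightarrow> y \<in> B \<Longrightarrow> v d \<le> v (y - x) \<Longrightarrow>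
      v (\<epsilon> * (y - x)) \<le> v (f y - f x - D x * (y - x))"
    by metis
  have a: "a \<in> open_ball v a \<gamma>"
    by (rule open_ball_center[OF val])
  have "v (\<epsilon> * (x - y)) \<le> v (f x - f y - D a * (x - y))"
    if xy: "x \<in> B" "y \<in> B" "v d' \<le> v (x - a)" "v d' \<le> v (y - a)" for x y
  proof -
    have y: "y \<in> open_ball v a \<gamma>"
      using xy(4) d'(2) by (simp add: open_ball_def order_less_le_trans)
    \<comment> \<open>By the ultrametric inequality \<open>x\<close> is close enough to
      \<open>y\<close> for the approximation centred at \<open>y\<close> to apply.\<close>
    have "v d' \<le> v (x - y)"
      using valuation_diff_ge[OF val xy(3,4)] by simp
    then have 1: "v (\<epsilon> * (x - y)) \<le> v (f x - f y - D y * (x - y))"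
      using D[OF y xy(1)] d'(3) by simp
    have 2: "v (\<epsilon> * (x - y)) \<le> v ((D y - D a) * (x - y))"
    proof (cases "y = a")
      case True
      then show ?thesis
        using valuation_zero_iff[OF val, of 0] by simp
    next
      case False
      \<comment> \<open>The pair of \<open>y\<close> and \<open>a\<close> is measured once from
        \<open>a\<close> and once from \<open>y\<close>; in the sum the values of \<open>f\<close>
        cancel and only the difference of the two slopes remains.\<close>
      have "v (\<epsilon> * (y - a)) \<le> v (f y - f a - D a * (y - a))"
        using D[OF a xy(2)] d'(3) xy(4) by simp
      moreover have "v (\<epsilon> * (y - a)) \<le> v (f a - f y - D y * (a - y))"
      proof -
        have "v (\<epsilon> * (a - y)) \<le> v (f a - f y - D y * (a - y))"
          using D[OF y, of a] ball[OF a] d'(3) xy(4) valuation_minus_commute[OF val, of a y] by simp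
        then show ?thesis
          using valuation_minus[OF val, of "\<epsilon> * (a - y)"] by (simp add: algebra_simps)
      qed
      ultimately have "v (\<epsilon> * (y - a)) \<le>
          v ((f y - f a - D a * (y - a)) + (f a - f y - D y * (a - y)))"
        by (rule valuation_add_ge[OF val])
      also have "(f y - f a - D a * (y - a)) + (f a - f y - D y * (a - y)) = (D y - D a) * (y - a)"
        by (simp add: algebra_simps)
      finally have "v \<epsilon> \<le> v (D y - D a)"
        using valuation_mult_le_cancel[OF val, of "y - a"] False by simp
      then show ?thesis
        by (rule valuation_mult_mono[OF val])
    qed
    \<comment> \<open>Replacing the slope at \<open>y\<close> by the fixed slope at \<open>a\<close>
      costs an error within the same bound.\<close>
    have "f x - f y - D a * (x - y) = (f x - f y - D y * (x - y)) + (D y - D a) * (x - y)"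
      by (simp add: algebra_simps)
    then show ?thesis
      using valuation_add_ge[OF val 1 2] by metis
  qed
  then show ?thesis
    unfolding approx_strict_diff_def using d'(1) by blast
qed

section \<open>Strict differentiability\<close>

text \<open>Balls are open, and \<open>a + d\<close> approaches \<open>a\<close> as
  \<open>v d\<close> grows. So limits at \<open>a\<close> along \<open>B\<close> are not vacuous,
  which makes derivatives unique and comparable with approximate ones.\<close>

lemma ball_limit_point:
  assumes nt: "nontrivial_valuation v" and "is_ball v B" "a \<in> B"
  obtains x where "x \<in> B" "x \<noteq> a" "Fin \<gamma> < v (x - a)"
proof -
  have val: "valuation v"
    using nt by (simp add: nontrivial_valuation_def)
  obtain \<delta> where "open_ball v a \<delta> \<subseteq> B \<or> open_ball v a \<delta> \<subseteq> - B"
    using is_ball_clopen[OF val assms(2)] by blast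
  then have \<delta>: "open_ball v a \<delta> \<subseteq> B"
    using assms(3) open_ball_center[OF val] by blast
  obtain d where d: "d \<noteq> 0" "Fin (max \<gamma> \<delta>) < v d"
    using valuation_greater[OF nt] .
  then have "a + d \<in> B" "a + d \<noteq> a" "Fin \<gamma> < v (a + d - a)"
    using \<delta> by (auto simp: open_ball_def Fin_max_less_iff)
  then show thesis
    using that by blast
qed

text \<open>Evaluates the \<open>THE\<close> in \<open>val_deriv\<close>: if \<open>D'\<close>
  differed from \<open>D\<close>, one quotient near \<open>a\<close> would approximate both to
  within more than \<open>v (D' - D)\<close>, against the ultrametric inequality.\<close>

lemma val_deriv_eq:
  assumes nt: "nontrivial_valuation v" and B: "is_ball v B" "a \<in> B"
    and D: "has_val_deriv v B f a D"
  shows "val_deriv v B f a = D"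
  unfolding val_deriv_def
proof (rule the_equality, rule D, rule ccontr)
  fix D' assume D': "has_val_deriv v B f a D'" and "D' \<noteq> D"
  have val: "valuation v"
    using nt by (simp add: nontrivial_valuation_def)
  have "D' - D \<noteq> 0"
    using \<open>D' \<noteq> D\<close> by simp
  then obtain g where g: "v (D' - D) = Fin g"
    by (rule valuation_Fin[OF val])
  let ?q = "\<lambda>x. (f x - f a) / (x - a)"
  have "\<forall>\<^sub>F x in atin_within (valuation_topology v) a B. Fin g < v (?q x - D) \<and> Fin g < v (?q x - D')"
    using D D' by (simp add: has_val_deriv_def limitin_valuation_topology[OF val] eventually_conj_iff)
  then obtain \<gamma> where \<gamma>: "\<forall>x\<in>B. x \<noteq> a \<and> Fin \<gamma> < v (x - a) \<longrightarrow>
      Fin g < v (?q x - D) \<and> Fin g < v (?q x - D')"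
    by (auto simp: eventually_atin_valuation_topology[OF val])
  obtain x where "x \<in> B" "x \<noteq> a" "Fin \<gamma> < v (x - a)"
    using ball_limit_point[OF nt B] .
  then have "Fin g < v (?q x - D)" "Fin g < v (D' - ?q x)"
    using \<gamma> valuation_minus_commute[OF val] by metis+
  from valuation_add_gt[OF val this] show False
    using g by simp
qed

text \<open>The slope in \<open>approx_strict_diff\<close> may vary with \<open>\<epsilon>\<close>
  and need not be \<open>D\<close>. Comparing both with a quotient based at \<open>a\<close> shows
  that it agrees with \<open>D\<close> up to the required precision.\<close>

lemma limitin_diff_quotient:
  assumes nt: "nontrivial_valuation v" and B: "is_ball v B" "a \<in> B"
    and deriv: "has_val_deriv v B f a D"
    and strict: "\<And>\<epsilon>. \<epsilon> \<noteq> 0 \<Longrightarrow> approx_strict_diff v B f \<epsilon> a"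
  shows "limitin (valuation_topology v) (\<lambda>(x, y). (f x - f y) / (x - y)) D
           (atin_within (prod_topology (valuation_topology v) (valuation_topology v))
              (a, a) {(x, y). x \<in> B \<and> y \<in> B \<and> x \<noteq> y})"
proof -
  have val: "valuation v"
    using nt by (simp add: nontrivial_valuation_def)
  let ?F = "atin_within (prod_topology (valuation_topology v) (valuation_topology v))
    (a, a) {(x, y). x \<in> B \<and> y \<in> B \<and> x \<noteq> y}"
  have "\<forall>\<^sub>F z in ?F. Fin \<gamma> < v ((case z of (x, y) \<Rightarrow> (f x - f y) / (x - y)) - D)" for \<gamma>
  proof -
    obtain \<epsilon> where \<epsilon>: "\<epsilon> \<noteq> 0" "Fin \<gamma> < v \<epsilon>"
      using valuation_greater[OF nt] .
    obtain D' d where d: "d \<noteq> 0" and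
      D': "\<And>x y. x \<in> B \<Longrightarrow> y \<in> B \<Longrightarrow> v d \<le> v (x - a) \<Longrightarrow> v d \<le> v (y - a) \<Longrightarrow>
        v (\<epsilon> * (x - y)) \<le> v (f x - f y - D' * (x - y))"
      using strict[OF \<epsilon>(1)] unfolding approx_strict_diff_def by blast
    have quot: "Fin \<gamma> < v ((f x - f y) / (x - y) - D')"
      if "x \<in> B" "y \<in> B" "v d \<le> v (x - a)" "v d \<le> v (y - a)" "x \<noteq> y" for x y
    proof -
      have "f x - f y - D' * (x - y) = ((f x - f y) / (x - y) - D') * (x - y)"
        using that(5) by (simp add: diff_quotient_mult)
      then have "v \<epsilon> \<le> v ((f x - f y) / (x - y) - D')"
        using D'[OF that(1-4)] valuation_mult_le_cancel[OF val, of "x - y"] that(5) by simp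
      then show ?thesis
        using \<epsilon>(2) by (rule order_less_le_trans[rotated])
    qed
    obtain g where g: "v d = Fin g"
      using valuation_Fin[OF val d] .
    have "\<forall>\<^sub>F x in atin_within (valuation_topology v) a B. Fin \<gamma> < v ((f x - f a) / (x - a) - D)"
      using deriv by (simp add: has_val_deriv_def limitin_valuation_topology[OF val])
    then obtain \<delta> where \<delta>: "\<And>x. x \<in> B \<Longrightarrow> x \<noteq> a \<Longrightarrow> Fin \<delta> < v (x - a) \<Longrightarrow>
        Fin \<gamma> < v ((f x - f a) / (x - a) - D)"
      by (auto simp: eventually_atin_valuation_topology[OF val])
    \<comment> \<open>The maximum puts \<open>x\<close> in the range of both estimates, so its
      quotient based at \<open>a\<close> is close to \<open>D\<close> and to
      \<open>D'\<close>.\<close>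
    obtain x where x: "x \<in> B" "x \<noteq> a" "Fin (max g \<delta>) < v (x - a)"
      using ball_limit_point[OF nt B] .
    from x(3) have x': "v d \<le> v (x - a)" "Fin \<delta> < v (x - a)"
      using g by (auto simp: Fin_max_less_iff order_less_imp_le)
    have "Fin \<gamma> < v ((f x - f a) / (x - a) - D)"
      using \<delta> x x' by blast
    moreover have "v d \<le> v (a - a)"
      using valuation_zero_iff[OF val, of 0] by simp
    then have "Fin \<gamma> < v (D' - (f x - f a) / (x - a))"
      using quot[of x a] x x' B(2) valuation_minus_commute[OF val, of D'] by metis
    ultimately have "Fin \<gamma> < v (((f x - f a) / (x - a) - D) + (D' - (f x - f a) / (x - a)))"
      by (rule valuation_add_gt[OF val])
    then have DD': "Fin \<gamma> < v (D' - D)"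
      by simp
    have "Fin \<gamma> < v ((f x - f y) / (x - y) - D)"
      if "x \<in> B" "y \<in> B" "x \<in> open_ball v a g" "y \<in> open_ball v a g" "x \<noteq> y" for x y
    proof -
      have "Fin \<gamma> < v ((f x - f y) / (x - y) - D')"
        using that by (intro quot) (auto simp: open_ball_def g)
      from valuation_add_gt[OF val this DD'] show ?thesis
        by simp
    qed
    then show ?thesis
      unfolding eventually_atin_within
      using openin_open_ball[OF val, of a g] open_ball_center[OF val, of a g]
      by (intro disjI2 exI[of _ "open_ball v a g \<times> open_ball v a g"])
        (auto simp: openin_prod_Times_iff)
  qed
  then show ?thesis
    by (simp add: limitin_valuation_topology[OF val])
qed

section \<open>Definability of the exceptional sets\<close>

definition fo_all :: "nat \<Rightarrow> ('f, 'r) fo_formula \<Rightarrow> ('f, 'r) fo_formula" where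
  "fo_all n \<phi> = Neg (Exi n (Neg \<phi>))"

definition fo_imp :: "('f, 'r) fo_formula \<Rightarrow> ('f, 'r) fo_formula \<Rightarrow> ('f, 'r) fo_formula" where
  "fo_imp \<phi> \<psi> = Neg (Conj \<phi> (Neg \<psi>))"

definition fo_nonzero :: "('f, 'r) valued_field_language \<Rightarrow> 'f fo_term \<Rightarrow> ('f, 'r) fo_formula" where
  "fo_nonzero L s = Neg (Eq s (App (zero_sym L) []))"

definition fo_minus :: "('f, 'r) valued_field_language \<Rightarrow> 'f fo_term \<Rightarrow> 'f fo_term \<Rightarrow> 'f fo_term" where
  "fo_minus L s u = App (add_sym L) [s, App (neg_sym L) [u]]"

definition fo_mult :: "('f, 'r) valued_field_language \<Rightarrow> 'f fo_term \<Rightarrow> 'f fo_term \<Rightarrow> 'f fo_term" where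
  "fo_mult L s u = App (mult_sym L) [s, u]"

definition fo_le ::
  "('f, 'r) valued_field_language \<Rightarrow> 'f fo_term \<Rightarrow> 'f fo_term \<Rightarrow> ('f, 'r) fo_formula" where
  "fo_le L s u = Rel (div_sym L) [s, u]"

lemmas fo_defs = fo_all_def fo_imp_def fo_nonzero_def fo_minus_def fo_mult_def fo_le_def

lemma wf_fo:
  assumes "expands_valued_field L M v"
  shows "wf_formula L (fo_all n \<phi>) = wf_formula L \<phi>"
    "wf_formula L (fo_imp \<phi> \<psi>) = (wf_formula L \<phi> \<and> wf_formula L \<psi>)"
    "wf_formula L (fo_nonzero L s) = wf_term L s"
    "wf_term L (fo_minus L s u) = (wf_term L s \<and> wf_term L u)"
    "wf_term L (fo_mult L s u) = (wf_term L s \<and> wf_term L u)"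
    "wf_formula L (fo_le L s u) = (wf_term L s \<and> wf_term L u)"
  using assms by (simp_all add: fo_defs expands_valued_field_def)

lemma sat_fo:
  assumes "expands_valued_field L M v"
  shows "sat M e (fo_all n \<phi>) = (\<forall>x. sat M (e(n := x)) \<phi>)"
    "sat M e (fo_imp \<phi> \<psi>) = (sat M e \<phi> \<longrightarrow> sat M e \<psi>)"
    "sat M e (fo_nonzero L s) = (eval_term M e s \<noteq> 0)"
    "eval_term M e (fo_minus L s u) = eval_term M e s - eval_term M e u"
    "eval_term M e (fo_mult L s u) = eval_term M e s * eval_term M e u"
    "sat M e (fo_le L s u) = (v (eval_term M e s) \<le> v (eval_term M e u))"
  using assms by (simp_all add: fo_defs expands_valued_field_def)

text \<open>The parameters of the formula defining the graph are moved out of the way of the variables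
  \<open>0, \<dots>, 9\<close>.\<close>

definition shift_graph :: "('f, 'r) fo_formula \<Rightarrow> nat \<Rightarrow> nat \<Rightarrow> ('f, 'r) fo_formula" where
  "shift_graph \<phi> i j = rename_formula (\<lambda>k. if k = 0 then i else if k = 1 then j else k + 10) \<phi>"

text \<open>Lets the graph be used at any two distinct variables below 10. Quantifying over such
  variables leaves the shifted parameters \<open>e0\<close> untouched.\<close>

lemma definable_function_on_graph:
  assumes "definable_function_on L M B f"
  obtains \<phi> e0 where "wf_formula L \<phi>"
    "\<And>e i j. i < 10 \<Longrightarrow> j < 10 \<Longrightarrow> i \<noteq> j \<Longrightarrow> (\<And>k. k \<ge> 10 \<Longrightarrow> e k = e0 k) \<Longrightarrow>
       sat M e (shift_graph \<phi> i j) \<longleftrightarrow> e i \<in> B \<and> e j = f (e i)"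
proof -
  obtain \<phi> e1 where wf: "wf_formula L \<phi>" and
    graph: "{[x, f x] | x. x \<in> B} = {xs. length xs = 2 \<and> sat M (\<lambda>i. if i < 2 then xs ! i else e1 i) \<phi>}"
    using assms unfolding definable_function_on_def definable_def by blast
  have "sat M e (shift_graph \<phi> i j) \<longleftrightarrow> e i \<in> B \<and> e j = f (e i)"
    if "i < 10" "j < 10" "i \<noteq> j" "\<And>k. k \<ge> 10 \<Longrightarrow> e k = e1 (k - 10)" for e i j
  proof -
    let ?\<sigma> = "\<lambda>k::nat. if k = 0 then i else if k = 1 then j else k + 10"
    have "inj ?\<sigma>"
      using that(1-3) by (auto simp: inj_def)
    moreover have "e \<circ> ?\<sigma> = (\<lambda>k. if k < 2 then [e i, e j] ! k else e1 k)"
      using that(4) by (auto simp: fun_eq_iff less_2_cases_iff)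
    ultimately have "sat M e (shift_graph \<phi> i j) \<longleftrightarrow> [e i, e j] \<in> {[x, f x] | x. x \<in> B}"
      unfolding graph by (simp add: shift_graph_def sat_rename_formula)
    then show ?thesis
      by auto
  qed
  then show thesis
    using that[of \<phi> "\<lambda>k. e1 (k - 10)"] wf by blast
qed

text \<open>The point \<open>a\<close> is the variable 0; \<open>d\<close> and \<open>\<epsilon>\<close> are the variables 1 and 2.\<close>

definition approx_diff_formula ::
  "('f, 'r) valued_field_language \<Rightarrow> ('f, 'r) fo_formula \<Rightarrow> ('f, 'r) fo_formula" where
  "approx_diff_formula L \<phi> = Exi 3 (Exi 4 (Conj (shift_graph \<phi> 0 4) (fo_all 5 (fo_all 6
     (fo_imp (Conj (shift_graph \<phi> 5 6) (fo_le L (Var 1) (fo_minus L (Var 5) (Var 0))))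
       (fo_le L (fo_mult L (Var 2) (fo_minus L (Var 5) (Var 0)))
         (fo_minus L (fo_minus L (Var 6) (Var 4)) (fo_mult L (Var 3) (fo_minus L (Var 5) (Var 0))))))))))"

text \<open>The point \<open>a\<close> is the variable 0, and \<open>\<epsilon>\<close> is the variable \<open>n\<close>.\<close>

definition not_approx_strict_diff_formula ::
  "('f, 'r) valued_field_language \<Rightarrow> ('f, 'r) fo_formula \<Rightarrow> nat \<Rightarrow> ('f, 'r) fo_formula" where
  "not_approx_strict_diff_formula L \<phi> n = Conj (Exi 3 (shift_graph \<phi> 0 3)) (Neg (Exi 3 (Exi 4
     (Conj (fo_nonzero L (Var 4)) (fo_all 5 (fo_all 6 (fo_all 7 (fo_all 8
       (fo_imp (Conj (Conj (shift_graph \<phi> 5 6) (shift_graph \<phi> 7 8))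
           (Conj (fo_le L (Var 4) (fo_minus L (Var 5) (Var 0)))
             (fo_le L (Var 4) (fo_minus L (Var 7) (Var 0)))))
         (fo_le L (fo_mult L (Var n) (fo_minus L (Var 5) (Var 7)))
           (fo_minus L (fo_minus L (Var 6) (Var 8))
             (fo_mult L (Var 3) (fo_minus L (Var 5) (Var 7))))))))))))))"

text \<open>As \<open>f\<close> need not be a symbol, each of its values is a quantified variable
  tied to its argument by the graph, which also confines the argument to \<open>B\<close>. The
  precision is variable 2 while variable 1 holds \<open>d\<close>, and variable 1 when it is itself
  the chain index.\<close>

lemma sat_diff_formulas:
  assumes L: "expands_valued_field L M v"
    and graph: "\<And>e i j. i < 10 \<Longrightarrow> j < 10 \<Longrightarrow> i \<noteq> j \<Longrightarrow> (\<And>k. k \<ge> 10 \<Longrightarrow> e k = e0 k) \<Longrightarrow>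
       sat M e (shift_graph \<phi> i j) \<longleftrightarrow> e i \<in> B \<and> e j = f (e i)"
    and e: "\<And>k. k \<ge> 10 \<Longrightarrow> e k = e0 k"
  shows "sat M e (approx_diff_formula L \<phi>) \<longleftrightarrow> e 0 \<in> B \<and> approx_diff v B f (e 2) (e 1) (e 0)"
    and "n \<in> {1, 2} \<Longrightarrow> sat M e (not_approx_strict_diff_formula L \<phi> n) \<longleftrightarrow>
      e 0 \<in> B \<and> \<not> approx_strict_diff v B f (e n) (e 0)"
proof -
  show "sat M e (approx_diff_formula L \<phi>) \<longleftrightarrow> e 0 \<in> B \<and> approx_diff v B f (e 2) (e 1) (e 0)"
    by (simp add: approx_diff_formula_def approx_diff_def sat_fo[OF L] graph e) blast
  assume "n \<in> {1, 2}"
  then show "sat M e (not_approx_strict_diff_formula L \<phi> n) \<longleftrightarrow>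
      e 0 \<in> B \<and> \<not> approx_strict_diff v B f (e n) (e 0)"
    by (elim insertE) (simp_all add: not_approx_strict_diff_formula_def approx_strict_diff_def
        sat_fo[OF L] graph e, blast+)
qed

lemma wf_diff_formulas:
  assumes "expands_valued_field L M v" "wf_formula L \<phi>"
  shows "wf_formula L (approx_diff_formula L \<phi>)"
    "wf_formula L (not_approx_strict_diff_formula L \<phi> n)"
  using assms(2)
  by (simp_all add: approx_diff_formula_def not_approx_strict_diff_formula_def shift_graph_def
      wf_rename_formula wf_fo[OF assms(1)])

section \<open>Finiteness of the exceptional set\<close>

lemma finite_not_approx_strict_diff:
  fixes v :: "'a::field \<Rightarrow> 'g::linordered_ab_group_add extended"
  assumes L: "expands_valued_field L M v" and nt: "nontrivial_valuation v"
    and cmin: "C_minimal L M v" and mon: "monster_model L M \<kappa>"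
    and f: "definable_function_on L M B f" "val_differentiable_on v B f"
  shows "finite {a \<in> B. \<exists>\<epsilon>. \<epsilon> \<noteq> 0 \<and> \<not> approx_strict_diff v B f \<epsilon> a}"
proof -
  have val: "valuation v"
    using nt by (simp add: nontrivial_valuation_def)
  obtain \<phi> e0 where wf: "wf_formula L \<phi>"
    and graph: "\<And>e i j. i < 10 \<Longrightarrow> j < 10 \<Longrightarrow> i \<noteq> j \<Longrightarrow> (\<And>k. k \<ge> 10 \<Longrightarrow> e k = e0 k) \<Longrightarrow>
       sat M e (shift_graph \<phi> i j) \<longleftrightarrow> e i \<in> B \<and> e j = f (e i)"
    using definable_function_on_graph[OF f(1)] by blast
  have diff: "sat M e (approx_diff_formula L \<phi>) \<longleftrightarrow> e 0 \<in> B \<and> approx_diff v B f (e 2) (e 1) (e 0)"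
    if "\<And>k. k \<ge> 10 \<Longrightarrow> e k = e0 k" for e
    by (rule sat_diff_formulas(1)[OF L _ that]) (rule graph; simp)
  have strict: "sat M e (not_approx_strict_diff_formula L \<phi> n) \<longleftrightarrow>
      e 0 \<in> B \<and> \<not> approx_strict_diff v B f (e n) (e 0)"
    if "n \<in> {1, 2}" "\<And>k. k \<ge> 10 \<Longrightarrow> e k = e0 k" for e n
    by (rule sat_diff_formulas(2)[OF L _ that(2,1)]) (rule graph; simp)
  have fin: "finite {a \<in> B. \<not> approx_strict_diff v B f \<epsilon> a}" if "\<epsilon> \<noteq> 0" for \<epsilon>
  proof -
    \<comment> \<open>First union: the chain index \<open>d\<close> is variable 1 and
      \<open>\<epsilon>\<close> a parameter in variable 2. The nonzero clause makes the member for
      \<open>d = 0\<close> empty.\<close>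
    define \<psi> where "\<psi> = Conj (fo_nonzero L (Var 1))
      (Conj (approx_diff_formula L \<phi>) (not_approx_strict_diff_formula L \<phi> 2))"
    let ?p = "e0(2 := \<epsilon>)"
    have wf\<psi>: "wf_formula L \<psi>"
      by (simp add: \<psi>_def wf_diff_formulas[OF L wf] wf_fo[OF L])
    have sat: "sat M (?p(0 := a, 1 := d)) \<psi> \<longleftrightarrow>
        d \<noteq> 0 \<and> a \<in> B \<and> approx_diff v B f \<epsilon> d a \<and> \<not> approx_strict_diff v B f \<epsilon> a" for a d
      by (simp add: \<psi>_def diff strict sat_fo[OF L]) blast
    have "finite {a. \<exists>d. sat M (?p(0 := a, 1 := d)) \<psi>}"
    proof (rule monster_model_chain_finite[OF mon wf\<psi>])
      fix d
      let ?X = "{a. sat M (?p(0 := a, 1 := d)) \<psi>}"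
      have "definable_set L M ?X"
        by (rule definable_setI[OF wf\<psi>, where e = "?p(1 := d)"]) (simp add: fun_upd_twist)
      then have bpc: "?X \<in> ball_point_combinations v"
        using cmin by (simp add: C_minimal_def)
      show "finite ?X"
      proof (rule ccontr)
        assume "infinite ?X"
        then obtain a \<gamma> where a: "open_ball v a \<gamma> \<subseteq> ?X"
          using infinite_ball_point_combination_contains_ball[OF val bpc] by blast
        then have "d \<noteq> 0" "\<not> approx_strict_diff v B f \<epsilon> a"
          using open_ball_center[OF val] unfolding sat by blast+
        \<comment> \<open>All points of the ball share the radius \<open>v d\<close>, so their
          approximations combine to a strict one at the centre, which membership in
          \<open>?X\<close> forbids.\<close>
        moreover have "approx_strict_diff v B f \<epsilon> a"
          using a unfolding sat by (intro approx_strict_diffI[OF nt \<open>d \<noteq> 0\<close>]) auto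
        ultimately show False
          by simp
      qed
    next
      fix d d'
      have "v d \<le> v d' \<or> v d' \<le> v d"
        by (rule linear)
      then show "(\<forall>a. sat M (?p(0 := a, 1 := d)) \<psi> \<longrightarrow> sat M (?p(0 := a, 1 := d')) \<psi>) \<or>
          (\<forall>a. sat M (?p(0 := a, 1 := d')) \<psi> \<longrightarrow> sat M (?p(0 := a, 1 := d)) \<psi>)"
        unfolding sat by (cases "d = 0"; cases "d' = 0") (auto intro: approx_diff_mono)
    qed
    \<comment> \<open>Differentiability at \<open>a\<close> provides a suitable
      \<open>d\<close>.\<close>
    moreover have "{a \<in> B. \<not> approx_strict_diff v B f \<epsilon> a} \<subseteq> {a. \<exists>d. sat M (?p(0 := a, 1 := d)) \<psi>}"
      using f(2) approx_diff_exists[OF nt that] unfolding sat val_differentiable_on_def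
      by (smt (verit) Collect_mono)
    ultimately show ?thesis
      by (rule rev_finite_subset)
  qed
  \<comment> \<open>Second union, now over the precision: its members are empty for
    \<open>\<epsilon> = 0\<close> and finite by the first union otherwise.\<close>
  define \<chi> where "\<chi> = Conj (fo_nonzero L (Var 1)) (not_approx_strict_diff_formula L \<phi> 1)"
  have wf\<chi>: "wf_formula L \<chi>"
    by (simp add: \<chi>_def wf_diff_formulas[OF L wf] wf_fo[OF L])
  have sat: "sat M (e0(0 := a, 1 := \<epsilon>)) \<chi> \<longleftrightarrow>
      \<epsilon> \<noteq> 0 \<and> a \<in> B \<and> \<not> approx_strict_diff v B f \<epsilon> a" for a \<epsilon>
    by (simp add: \<chi>_def strict sat_fo[OF L])
  have "finite {a. \<exists>\<epsilon>. sat M (e0(0 := a, 1 := \<epsilon>)) \<chi>}"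
  proof (rule monster_model_chain_finite[OF mon wf\<chi>])
    fix \<epsilon>
    show "finite {a. sat M (e0(0 := a, 1 := \<epsilon>)) \<chi>}"
      using fin[of \<epsilon>] unfolding sat by (cases "\<epsilon> = 0") auto
  next
    fix \<epsilon> \<epsilon>'
    have "v \<epsilon> \<le> v \<epsilon>' \<or> v \<epsilon>' \<le> v \<epsilon>"
      by (rule linear)
    then show "(\<forall>a. sat M (e0(0 := a, 1 := \<epsilon>)) \<chi> \<longrightarrow> sat M (e0(0 := a, 1 := \<epsilon>')) \<chi>) \<or>
        (\<forall>a. sat M (e0(0 := a, 1 := \<epsilon>')) \<chi> \<longrightarrow> sat M (e0(0 := a, 1 := \<epsilon>)) \<chi>)"
      unfolding sat
      by (cases "\<epsilon> = 0"; cases "\<epsilon>' = 0") (auto intro: approx_strict_diff_antimono[OF val])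
  qed
  then show ?thesis
    unfolding sat by (rule rev_finite_subset) auto
qed

theorem theorem8p2:
  fixes L :: "('f, 'r) valued_field_language"
    and M :: "('f, 'r, 'a::alg_closed_field) fo_structure"
    and v :: "'a \<Rightarrow> 'g::linordered_ab_group_add extended"
    and \<kappa> :: "'k rel"
    and t :: 'f
    and B :: "'a set"
    and f :: "'a \<Rightarrow> 'a"
  assumes "expands_ACVF L M v"
    and "C_minimal L M v"
    and "monster_model L M \<kappa>"
    and "fun_arity L t = 0" and "0 < v (fun_interp M t [])"
    and "is_ball v B"
    and "definable_function_on L M B f"
    and "val_differentiable_on v B f"
  shows "finite {a \<in> B. \<not> limitin (valuation_topology v)
           (\<lambda>(x, y). (f x - f y) / (x - y)) (val_deriv v B f a)
           (atin_within (prod_topology (valuation_topology v) (valuation_topology v))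
              (a, a) {(x, y). x \<in> B \<and> y \<in> B \<and> x \<noteq> y})}"
    (is "finite {a \<in> B. \<not> ?strict a}")
proof -
  have L: "expands_valued_field L M v" and nt: "nontrivial_valuation v"
    using assms(1) by (simp_all add: expands_ACVF_def)
  \<comment> \<open>Where approximate strict derivatives of every precision exist, the limit exists
    and equals the derivative, which is unique.\<close>
  have "?strict a" if a: "a \<in> B" "\<And>\<epsilon>. \<epsilon> \<noteq> 0 \<Longrightarrow> approx_strict_diff v B f \<epsilon> a" for a
  proof -
    obtain D where D: "has_val_deriv v B f a D"
      using assms(8) a(1) by (auto simp: val_differentiable_on_def)
    show ?thesis
      using limitin_diff_quotient[OF nt assms(6) a(1) D a(2)] val_deriv_eq[OF nt assms(6) a(1) D]
      by simp
  qed
  then have "{a \<in> B. \<not> ?strict a} \<subseteq> {a \<in> B. \<exists>\<epsilon>. \<epsilon> \<noteq> 0 \<and> \<not> approx_strict_diff v B f \<epsilon> a}"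
    by blast
  then show ?thesis
    using finite_not_approx_strict_diff[OF L nt assms(2,3,7,8)] by (rule finite_subset)
qed

end
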